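(* Let $\lambda_0, s_0$ be functions of the integer variable $x$, and define functions $\lambda_k, s_k$ for $k\ge 1$ recursively by $$\lambda_k(x)=\Delta \lambda_{k-1}(x)+\lambda_{k-1}(x+1)\lambda_0(x)+s_{k-1}(x+1),\qquad s_k(x)=\Delta s_{k-1}(x)+\lambda_{k-1}(x+1)s_0(x).$$ Suppose that for some integer $n\ge 1$, $$\frac{s_n(x)}{\lambda_n(x)}=\frac{s_{n-1}(x)}{\lambda_{n-1}(x)}.$$ Let $n_0\ge 0$ be an integer (the initial point) and let $m\in\{0,1,2,\dots\}$. Then the general solution of $$\Delta^2 y(x)=\lambda_0(x)\,\Delta y(x)+s_0(x)\,y(x)$$ is given by $$y(x)=C_2\prod_{i=n_0}^{x-1}\left(1-\frac{s_{n-1}(i)}{\lambda_{n-1}(i)}\right)+C_1\sum_{i=n_0}^{x-1}\left(\prod_{\ell=i+1}^{x-1}\left(1-\frac{s_{n-1}(\ell)}{\lambda_{n-1}(\ell)}\right)\frac{\prod_{j=n_0}^{i-m-1}\left(1+\frac{\lambda_n(j)}{\lambda_{n-1}(j)}\right)}{\lambda_{n-1}(i)}\prod_{k=0}^{m-1}\left[1+\frac{\lambda_n(i-m+k)}{\lambda_{n-1}(i-m+k)}\right]\right),$$ where $C_1$ and $C_2$ are unit periodic functions.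
   Context: $\Delta$ is the forward difference operator, $\Delta f(x)=f(x+1)-f(x)$, and $\Delta^2=\Delta\circ\Delta$. A function $C$ is unit periodic if $C(x+1)=C(x)$ for all $x$; such functions play the role of constants for difference equations. "General solution" means that the expression is a solution and that the coefficient functions of $C_1$ and $C_2$ are two linearly independent solutions. Empty products equal $1$ and empty sums equal $0$. The displayed condition on $s_n/\lambda_n$ is an identity in $x$, and the functions and quotients appearing are understood to be defined at every point where they are evaluated.
   Formalization: For m≥1 with empty products 1 the formula fails near n0; proved as solution for x≥n0+m, and general if 1+λ0−s0≠0 on [n0,n0+m). With the product to i−m−1 read as a reciprocal when reversed, it is general for x≥n0 if 1+λ_n/λ_{n−1}≠0 on [n0−m,n0). *)

theory Defs
  imports Complex_Main
begin

definition fdiff :: "(int \<Rightarrow> 'a::ab_group_add) \<Rightarrow> int \<Rightarrow> 'a" where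
  "fdiff f x = f (x + 1) - f x"

definition unit_periodic :: "(int \<Rightarrow> 'a) \<Rightarrow> bool" where
  "unit_periodic C \<longleftrightarrow> (\<forall>x. C (x + 1) = C x)"

fun aim_lambda :: "(int \<Rightarrow> 'a::comm_ring) \<Rightarrow> (int \<Rightarrow> 'a) \<Rightarrow> nat \<Rightarrow> int \<Rightarrow> 'a"
  and aim_s :: "(int \<Rightarrow> 'a::comm_ring) \<Rightarrow> (int \<Rightarrow> 'a) \<Rightarrow> nat \<Rightarrow> int \<Rightarrow> 'a" where
  "aim_lambda l0 s0 0 x = l0 x"
| "aim_s l0 s0 0 x = s0 x"
| "aim_lambda l0 s0 (Suc k) x =
     fdiff (aim_lambda l0 s0 k) x + aim_lambda l0 s0 k (x + 1) * l0 x + aim_s l0 s0 k (x + 1)"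
| "aim_s l0 s0 (Suc k) x =
     fdiff (aim_s l0 s0 k) x + aim_lambda l0 s0 k (x + 1) * s0 x"

text \<open>The functions are total on the integers, but only their values on the half-line of all
  x with a \<open>\<le>\<close> x matter: equations and linear (in)dependence are read there.\<close>

definition solves_from ::
  "int \<Rightarrow> (int \<Rightarrow> 'a::comm_ring) \<Rightarrow> (int \<Rightarrow> 'a) \<Rightarrow> (int \<Rightarrow> 'a) \<Rightarrow> bool" where
  "solves_from a l0 s0 y \<longleftrightarrow>
     (\<forall>x\<ge>a. fdiff (fdiff y) x = l0 x * fdiff y x + s0 x * y x)"

definition lin_indep_from :: "int \<Rightarrow> (int \<Rightarrow> 'a::field) \<Rightarrow> (int \<Rightarrow> 'a) \<Rightarrow> bool" where
  "lin_indep_from a u v \<longleftrightarrow>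
     (\<forall>A B. unit_periodic A \<longrightarrow> unit_periodic B \<longrightarrow>
        (\<forall>x\<ge>a. A x * u x + B x * v x = 0) \<longrightarrow> (\<forall>x\<ge>a. A x = 0 \<and> B x = 0))"

definition all_combinations_solve ::
  "int \<Rightarrow> (int \<Rightarrow> 'a::field) \<Rightarrow> (int \<Rightarrow> 'a) \<Rightarrow> (int \<Rightarrow> 'a) \<Rightarrow> (int \<Rightarrow> 'a) \<Rightarrow> bool" where
  "all_combinations_solve a l0 s0 u v \<longleftrightarrow>
     (\<forall>C1 C2. unit_periodic C1 \<longrightarrow> unit_periodic C2 \<longrightarrow>
        solves_from a l0 s0 (\<lambda>x. C2 x * u x + C1 x * v x))"

text \<open>y = C2 u + C1 v is the general solution.\<close>

definition general_solution ::
  "int \<Rightarrow> (int \<Rightarrow> 'a::field) \<Rightarrow> (int \<Rightarrow> 'a) \<Rightarrow> (int \<Rightarrow> 'a) \<Rightarrow> (int \<Rightarrow> 'a) \<Rightarrow> bool" where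
  "general_solution a l0 s0 u v \<longleftrightarrow>
     all_combinations_solve a l0 s0 u v \<and>
     solves_from a l0 s0 u \<and> solves_from a l0 s0 v \<and> lin_indep_from a u v"

text \<open>Two readings of a product from a to b when b < a. Under the first one every such product
  is empty and equals 1. The second is the convention of indefinite products, for which
  splitting a product at an arbitrary intermediate index is always valid; it also gives 1 for
  b = a - 1, and agrees with the first one whenever b \<open>\<ge>\<close> a - 1.\<close>

definition plain_prod :: "(int \<Rightarrow> 'a::field) \<Rightarrow> int \<Rightarrow> int \<Rightarrow> 'a" where
  "plain_prod f a b = (\<Prod>j=a..b. f j)"

definition oriented_prod :: "(int \<Rightarrow> 'a::field) \<Rightarrow> int \<Rightarrow> int \<Rightarrow> 'a" where
  "oriented_prod f a b =
     (if a \<le> b + 1 then \<Prod>j=a..b. f j else 1 / (\<Prod>j=b+1..a-1. f j))"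

definition aim_sol_C2 ::
  "(int \<Rightarrow> 'a::field) \<Rightarrow> (int \<Rightarrow> 'a) \<Rightarrow> nat \<Rightarrow> int \<Rightarrow> int \<Rightarrow> 'a" where
  "aim_sol_C2 l0 s0 n n0 x =
     (\<Prod>i=n0..x-1. 1 - aim_s l0 s0 (n - 1) i / aim_lambda l0 s0 (n - 1) i)"

text \<open>The argument P says how the product from n0 to i - m - 1 is to be read; it is the only
  product in the formula whose upper limit can lie below its lower limit minus 1.\<close>

definition aim_sol_C1 ::
  "((int \<Rightarrow> 'a::field) \<Rightarrow> int \<Rightarrow> int \<Rightarrow> 'a) \<Rightarrow>
   (int \<Rightarrow> 'a) \<Rightarrow> (int \<Rightarrow> 'a) \<Rightarrow> nat \<Rightarrow> int \<Rightarrow> nat \<Rightarrow> int \<Rightarrow> 'a" where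
  "aim_sol_C1 P l0 s0 n n0 m x =
     (\<Sum>i=n0..x-1.
        (\<Prod>l=i+1..x-1. 1 - aim_s l0 s0 (n - 1) l / aim_lambda l0 s0 (n - 1) l)
        * (P (\<lambda>j. 1 + aim_lambda l0 s0 n j / aim_lambda l0 s0 (n - 1) j) n0 (i - int m - 1)
           / aim_lambda l0 s0 (n - 1) i)
        * (\<Prod>k<m. 1 + aim_lambda l0 s0 n (i - int m + int k)
                       / aim_lambda l0 s0 (n - 1) (i - int m + int k)))"

end

theory Submission
  imports Defs
begin

text \<open>Write \<open>r\<close> for the common ratio, \<open>p = 1 - r\<close> and \<open>q x = 1 + l0 x + r (x + 1)\<close>. Clearing
  denominators in the recursion for \<open>r\<close> gives \<open>1 + l0 - s0 = p q\<close>, so the second order operator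
  factors and the equation reads \<open>g (x + 1) = q x * g x\<close> for \<open>g x = y (x + 1) - p x * y x\<close>.
  The first basis solution has \<open>g = 0\<close>. Since \<open>1 + \<lambda>\<^sub>n x / \<lambda>\<^sub>n\<^sub>-\<^sub>1 x\<close> equals
  \<open>q x * \<lambda>\<^sub>n\<^sub>-\<^sub>1 (x + 1) / \<lambda>\<^sub>n\<^sub>-\<^sub>1 x\<close>, the summand of the second one solves the equation
  for \<open>g\<close>, and the sum is the variation of constants formula. The Casoratian of the two is
  the first solution times \<open>g\<close>.\<close>

text \<open>Unit steps reach every integer, upward and downward, so the coefficients in a general
  solution are genuine constants and pass through \<open>fdiff\<close>.\<close>

lemma unit_periodic_const:
  assumes "unit_periodic C"
  shows "C x = C y"
proof -
  have "C (z + 1) = C z" for z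
    using assms by (simp add: unit_periodic_def)
  from this have shift: "C z = C 0" for z
    by (induction z rule: int_induct[where k = 0]) (metis diff_add_cancel)+
  show ?thesis
    using shift[of x] shift[of y] by simp
qed

lemma all_combinations_solveI:
  assumes u: "solves_from a l0 s0 u" and v: "solves_from a l0 s0 v"
  shows "all_combinations_solve a l0 s0 u v"
  unfolding all_combinations_solve_def
proof (intro allI impI)
  fix C1 C2 :: "int \<Rightarrow> 'a"
  assume "unit_periodic C1" "unit_periodic C2"
  then have C: "C1 x = C1 0" "C2 x = C2 0" for x
    by (blast intro: unit_periodic_const)+
  have lin: "fdiff (\<lambda>x. C2 0 * f x + C1 0 * h x) = (\<lambda>x. C2 0 * fdiff f x + C1 0 * fdiff h x)"
    for f h
    by (simp add: fdiff_def fun_eq_iff algebra_simps)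
  have "solves_from a l0 s0 (\<lambda>x. C2 0 * u x + C1 0 * v x)"
    using u v by (simp add: solves_from_def lin distrib_left mult.left_commute)
  moreover have "(\<lambda>x. C2 x * u x + C1 x * v x) = (\<lambda>x. C2 0 * u x + C1 0 * v x)"
    using C by metis
  ultimately show "solves_from a l0 s0 (\<lambda>x. C2 x * u x + C1 x * v x)"
    by simp
qed

text \<open>Reading a vanishing combination at \<open>x\<close> and \<open>x + 1\<close> gives a
  homogeneous 2 by 2 system with the Casoratian as determinant. Cramer's rule kills both
  coefficients at \<open>x\<close>, and periodicity carries this to every point.\<close>

lemma lin_indep_fromI_Casoratian:
  assumes x: "x \<ge> a" and cas: "u x * v (x + 1) - u (x + 1) * v x \<noteq> 0"
  shows "lin_indep_from a u v"
  unfolding lin_indep_from_def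
proof (intro allI impI)
  fix A B :: "int \<Rightarrow> 'a" and y :: int
  assume per: "unit_periodic A" "unit_periodic B"
    and eq: "\<forall>x\<ge>a. A x * u x + B x * v x = 0"
  have 1: "A x * u x + B x * v x = 0"
    using eq x by simp
  have "A (x + 1) * u (x + 1) + B (x + 1) * v (x + 1) = 0"
    using eq x by simp
  then have 2: "A x * u (x + 1) + B x * v (x + 1) = 0"
    using per by (simp add: unit_periodic_def)
  have "A x * (u x * v (x + 1) - u (x + 1) * v x)
      = (A x * u x + B x * v x) * v (x + 1) - (A x * u (x + 1) + B x * v (x + 1)) * v x"
    by (simp add: algebra_simps)
  then have "A x = 0"
    using 1 2 cas by simp
  moreover have "B x * (u x * v (x + 1) - u (x + 1) * v x)
      = (A x * u (x + 1) + B x * v (x + 1)) * u x - (A x * u x + B x * v x) * u (x + 1)"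
    by (simp add: algebra_simps)
  then have "B x = 0"
    using 1 2 cas by simp
  ultimately show "A y = 0 \<and> B y = 0"
    using per unit_periodic_const by metis
qed

text \<open>With the shift E, \<open>sum\<close> and \<open>prod\<close> match the coefficients of
  the equation with those of (E - q)(E - p); \<open>y\<close> and \<open>g\<close> solve the two
  first order factors in turn.\<close>

lemma solves_from_factored:
  fixes l0 s0 p q g y :: "int \<Rightarrow> 'a::comm_ring_1"
  assumes sum: "\<And>x. x \<ge> a \<Longrightarrow> 2 + l0 x = q x + p (x + 1)"
    and prod: "\<And>x. x \<ge> a \<Longrightarrow> 1 + l0 x - s0 x = p x * q x"
    and y: "\<And>x. x \<ge> a \<Longrightarrow> y (x + 1) = p x * y x + g x"
    and g: "\<And>x. x \<ge> a \<Longrightarrow> g (x + 1) = q x * g x"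
  shows "solves_from a l0 s0 y"
  unfolding solves_from_def
proof (intro allI impI)
  fix x assume x: "a \<le> x"
  have "y (x + 1 + 1) = p (x + 1) * y (x + 1) + q x * g x"
    using y[of "x + 1"] g[OF x] x by simp
  also have "g x = y (x + 1) - p x * y x"
    using y[OF x] by simp
  also have "p (x + 1) * y (x + 1) + q x * (y (x + 1) - p x * y x)
      = (q x + p (x + 1)) * y (x + 1) - p x * q x * y x"
    by (simp add: algebra_simps)
  also have "\<dots> = (2 + l0 x) * y (x + 1) - (1 + l0 x - s0 x) * y x"
    by (simp add: sum[OF x] prod[OF x])
  finally show "fdiff (fdiff y) x = l0 x * fdiff y x + s0 x * y x"
    by (simp add: fdiff_def algebra_simps)
qed

lemma prod_int_Suc:
  fixes f :: "int \<Rightarrow> 'a::comm_monoid_mult"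
  assumes "a \<le> x"
  shows "(\<Prod>i=a..x. f i) = (\<Prod>i=a..x - 1. f i) * f x"
proof -
  have "{a..x} = insert x {a..x - 1}"
    using assms by auto
  then show ?thesis
    by (simp add: mult.commute)
qed

lemma prod_int_split:
  fixes f :: "int \<Rightarrow> 'a::comm_monoid_mult"
  assumes "a \<le> b" "b \<le> c"
  shows "(\<Prod>i=a..b - 1. f i) * (\<Prod>i=b..c - 1. f i) = (\<Prod>i=a..c - 1. f i)"
proof -
  have "{a..c - 1} = {a..b - 1} \<union> {b..c - 1}"
    using assms by auto
  then show ?thesis
    by (subst prod.union_disjoint[symmetric]) auto
qed

lemma prod_lessThan_shift_int:
  fixes f :: "int \<Rightarrow> 'a::comm_monoid_mult"
  shows "(\<Prod>k<m. f (i - int m + int k)) = (\<Prod>j=i - int m..i - 1. f j)"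
proof (rule prod.reindex_bij_witness[of _ "\<lambda>j. nat (j - (i - int m))" "\<lambda>k. i - int m + int k"])
qed auto

text \<open>The term at \<open>i = x\<close> has an empty product; each earlier term gains the
  factor \<open>p x\<close>.\<close>

lemma variation_of_constants_rec:
  fixes p g :: "int \<Rightarrow> 'a::comm_ring_1"
  assumes "a \<le> x"
  shows "(\<Sum>i=a..x. (\<Prod>l=i+1..x. p l) * g i)
    = p x * (\<Sum>i=a..x - 1. (\<Prod>l=i+1..x - 1. p l) * g i) + g x"
proof -
  have "{a..x} = insert x {a..x - 1}"
    using assms by auto
  then have "(\<Sum>i=a..x. (\<Prod>l=i+1..x. p l) * g i)
      = (\<Sum>i=a..x - 1. (\<Prod>l=i+1..x. p l) * g i) + g x"
    by simp
  moreover have "(\<Prod>l=i+1..x. p l) * g i = p x * ((\<Prod>l=i+1..x - 1. p l) * g i)"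
    if "i \<in> {a..x - 1}" for i
    using that prod_int_Suc[of "i + 1" x p] by (simp add: algebra_simps)
  ultimately show ?thesis
    by (simp add: sum_distrib_left)
qed

theorem theorem3p4:
  fixes l0 s0 :: "int \<Rightarrow> 'a::field" and n m :: nat and n0 :: int
  assumes n: "n \<ge> 1"
    and n0: "n0 \<ge> 0"
    and lambda_prev_nz: "\<And>x. x \<ge> n0 - int m \<Longrightarrow> aim_lambda l0 s0 (n - 1) x \<noteq> 0"
    and lambda_nz: "\<And>x. x \<ge> n0 \<Longrightarrow> aim_lambda l0 s0 n x \<noteq> 0"
    and s_over_lambda:
      "\<And>x. x \<ge> n0 \<Longrightarrow>
         aim_s l0 s0 n x / aim_lambda l0 s0 n x
           = aim_s l0 s0 (n - 1) x / aim_lambda l0 s0 (n - 1) x"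
  shows
    "all_combinations_solve (n0 + int m) l0 s0
       (aim_sol_C2 l0 s0 n n0) (aim_sol_C1 plain_prod l0 s0 n n0 m)
     \<and> ((\<forall>x\<in>{n0..<n0 + int m}. 1 + l0 x - s0 x \<noteq> 0) \<longrightarrow>
         general_solution (n0 + int m) l0 s0
           (aim_sol_C2 l0 s0 n n0) (aim_sol_C1 plain_prod l0 s0 n n0 m))
     \<and> ((\<forall>j\<in>{n0 - int m..<n0}. 1 + aim_lambda l0 s0 n j / aim_lambda l0 s0 (n - 1) j \<noteq> 0) \<longrightarrow>
         general_solution n0 l0 s0
           (aim_sol_C2 l0 s0 n n0) (aim_sol_C1 oriented_prod l0 s0 n n0 m))"
proof -
  define L S where "L = aim_lambda l0 s0 (n - 1)" and "S = aim_s l0 s0 (n - 1)"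
  define r where "r x = S x / L x" for x
  define p where "p x = 1 - r x" for x
  define q where "q x = 1 + l0 x + r (x + 1)" for x
  define w where "w = (\<lambda>x. 1 + aim_lambda l0 s0 n x / L x)"
  define u where "u = aim_sol_C2 l0 s0 n n0"
  define g where
    "g P x = P w n0 (x - int m - 1) / L x * (\<Prod>k<m. w (x - int m + int k))"
    for P :: "(int \<Rightarrow> 'a) \<Rightarrow> int \<Rightarrow> int \<Rightarrow> 'a" and x
  define v where "v P = aim_sol_C1 P l0 s0 n n0 m"
    for P :: "(int \<Rightarrow> 'a) \<Rightarrow> int \<Rightarrow> int \<Rightarrow> 'a"

  have L_nz: "L x \<noteq> 0" if "x \<ge> n0 - int m" for x
    using lambda_prev_nz[OF that] by (simp add: L_def)
  have S_eq: "S x = r x * L x" if "x \<ge> n0 - int m" for x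
    using L_nz[OF that] by (simp add: r_def)
  have lam: "aim_lambda l0 s0 n x = L (x + 1) - L x + L (x + 1) * l0 x + S (x + 1)"
    and s: "aim_s l0 s0 n x = S (x + 1) - S x + L (x + 1) * s0 x" for x
    using n by (cases n; simp add: L_def S_def fdiff_def)+

  have pq: "1 + l0 x - s0 x = p x * q x" if x: "x \<ge> n0" for x
  proof -
    have "aim_s l0 s0 n x = r x * aim_lambda l0 s0 n x"
      using s_over_lambda[OF x] lambda_nz[OF x] by (simp add: r_def L_def S_def field_simps)
    \<comment> \<open>After substituting \<open>S = r * L\<close>, the term \<open>r x * L x\<close>
      occurs on both sides and cancels, so \<open>L (x + 1)\<close> can be factored out.\<close>
    then have "L (x + 1) * (r (x + 1) + s0 x) = L (x + 1) * (r x * q x)"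
      using S_eq[of x] S_eq[of "x + 1"] x unfolding lam s q_def by (simp add: algebra_simps)
    then have "r (x + 1) + s0 x = r x * q x"
      using L_nz[of "x + 1"] x by simp
    then have "s0 x = r x * q x - r (x + 1)"
      by (simp add: algebra_simps)
    then show ?thesis
      by (simp add: p_def q_def algebra_simps)
  qed
  have p_q: "2 + l0 x = q x + p (x + 1)" for x
    by (simp add: p_def q_def)
  have w_eq: "w x = L (x + 1) * q x / L x" if "x \<ge> n0" for x
    using L_nz[of x] S_eq[of "x + 1"] that by (simp add: w_def lam q_def field_simps)

  have u_rec: "u (x + 1) = p x * u x" if "x \<ge> n0" for x
    using prod_int_Suc[OF that, of p]
    by (simp add: u_def aim_sol_C2_def p_def r_def L_def S_def mult.commute)
  have v_rec: "v P (x + 1) = p x * v P x + g P x" if "x \<ge> n0" for P x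
    using variation_of_constants_rec[OF that, of p "g P"]
    by (simp add: v_def aim_sol_C1_def g_def w_def p_def r_def L_def S_def mult.assoc)

  \<comment> \<open>The summand with its two \<open>w\<close> products merged, hence free of
    \<open>m\<close>. The factor \<open>L (x + 1) / L x\<close> of \<open>w x\<close> is absorbed by
    the division by \<open>L\<close>.\<close>
  define G where "G x = (\<Prod>j=n0..x - 1. w j) / L x" for x
  have G_rec: "G (x + 1) = q x * G x" if "x \<ge> n0" for x
    using prod_int_Suc[OF that, of w] w_eq[OF that] L_nz[of x] L_nz[of "x + 1"] that
    by (simp add: G_def field_simps)

  have sol: "solves_from a l0 s0 u" "solves_from a l0 s0 (v P)"
    if a: "a \<ge> n0" and gG: "\<And>x. x \<ge> a \<Longrightarrow> g P x = G x" for a P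
  proof -
    show "solves_from a l0 s0 u"
      by (rule solves_from_factored[of a _ q p _ _ "\<lambda>_. 0"]) (use a p_q pq u_rec in auto)
    show "solves_from a l0 s0 (v P)"
      by (rule solves_from_factored[of a _ q p _ _ "g P"]) (use a p_q pq v_rec gG G_rec in auto)
  qed
  have indep: "lin_indep_from a u (v P)"
    if a: "a \<ge> n0" and gG: "g P a = G a" and nz: "u a \<noteq> 0" "G a \<noteq> 0" for a P
  proof (rule lin_indep_fromI_Casoratian[OF order.refl])
    have "u a * v P (a + 1) - u (a + 1) * v P a = u a * G a"
      unfolding u_rec[OF a] v_rec[OF a] gG by (simp add: algebra_simps)
    then show "u a * v P (a + 1) - u (a + 1) * v P a \<noteq> 0"
      using nz by simp
  qed

  \<comment> \<open>From \<open>n0 + int m\<close> on, the two ranges of \<open>w\<close> are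
    adjacent. Below it the plain product is empty while the other one starts before
    \<open>n0\<close>.\<close>
  have plain: "g plain_prod x = G x" if "x \<ge> n0 + int m" for x
    using prod_int_split[of n0 "x - int m" x w] that
    by (simp add: g_def G_def plain_prod_def prod_lessThan_shift_int)
  have oriented: "g oriented_prod x = G x"
    if x: "x \<ge> n0" and nz: "\<forall>j\<in>{n0 - int m..<n0}. w j \<noteq> 0" for x
  proof (cases "x \<ge> n0 + int m")
    case True
    then have "g oriented_prod x = g plain_prod x"
      by (simp add: g_def oriented_prod_def plain_prod_def)
    then show ?thesis
      using plain[OF True] by simp
  next
    case False
    \<comment> \<open>Here the oriented product is the reciprocal of this one, and it cancels
      exactly the factors with index below \<open>n0\<close>.\<close>
    have nz': "(\<Prod>j=x - int m..n0 - 1. w j) \<noteq> 0"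
      using nz x by (auto simp: prod_zero_iff)
    have "(\<Prod>j=x - int m..x - 1. w j) = (\<Prod>j=x - int m..n0 - 1. w j) * (\<Prod>j=n0..x - 1. w j)"
      using prod_int_split[of "x - int m" n0 x w] False x by simp
    then show ?thesis
      unfolding g_def G_def prod_lessThan_shift_int
      using False nz' by (simp add: oriented_prod_def)
  qed

  let ?a = "n0 + int m"
  have "all_combinations_solve ?a l0 s0 u (v plain_prod)"
    by (intro all_combinations_solveI sol) (use plain in auto)
  \<comment> \<open>The Casoratian at \<open>?a\<close> is a product of values of \<open>p\<close>
    and \<open>w\<close> on \<open>{n0..<?a}\<close> divided by \<open>L ?a\<close>;
    \<open>nz\<close> keeps \<open>p\<close> and \<open>q\<close>, hence \<open>w\<close>, away from
    0.\<close>
  moreover have "general_solution ?a l0 s0 u (v plain_prod)"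
    if nz: "\<forall>x\<in>{n0..<?a}. 1 + l0 x - s0 x \<noteq> 0"
  proof -
    have pq_nz: "p x \<noteq> 0" "q x \<noteq> 0" if "n0 \<le> x" "x < ?a" for x
      using nz pq[of x] that by force+
    have "u ?a \<noteq> 0"
      using pq_nz(1) by (auto simp: u_def aim_sol_C2_def p_def r_def L_def S_def prod_zero_iff)
    moreover have "w x \<noteq> 0" if "n0 \<le> x" "x < ?a" for x
      using pq_nz(2)[OF that] w_eq[of x] L_nz[of x] L_nz[of "x + 1"] that by simp
    then have "G ?a \<noteq> 0"
      using L_nz[of ?a] by (auto simp: G_def prod_zero_iff)
    ultimately have "lin_indep_from ?a u (v plain_prod)"
      using plain[of ?a] by (intro indep) auto
    then show ?thesis
      using sol[of ?a plain_prod] plain by (auto simp: general_solution_def all_combinations_solveI)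
  qed
  moreover have "general_solution n0 l0 s0 u (v oriented_prod)"
    if nz: "\<forall>j\<in>{n0 - int m..<n0}. w j \<noteq> 0"
  proof -
    \<comment> \<open>At \<open>n0\<close> both products are empty, so the values are 1 and
      \<open>1 / L n0\<close>.\<close>
    have "u n0 \<noteq> 0" "G n0 \<noteq> 0"
      using L_nz[of n0] by (simp_all add: u_def aim_sol_C2_def G_def)
    then have "lin_indep_from n0 u (v oriented_prod)"
      using oriented[OF _ nz] by (intro indep) auto
    then show ?thesis
      using sol[of n0 oriented_prod] oriented[OF _ nz]
      by (auto simp: general_solution_def all_combinations_solveI)
  qed
  ultimately show ?thesis
    unfolding u_def v_def w_def L_def by blast
qed

end
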